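(* In every microcanonical theory, every noisy operation is unital. That is, if $\mathcal N$ is a noisy operation from a system $A$ to a system $A'$, then $\mathcal N\chi_A=\chi_{A'}$, where $\chi_A,\chi_{A'}$ are the microcanonical states of $A$ and $A'$.
   Context: Framework. A causal operational probabilistic theory (OPT) has systems $A,B,\dots$ (including a trivial system $I$), with associative composites $AB$ ($AI=IA=A$; $AB$ and $BA$ related by a reversible swap), and tests. A test from $A$ to $B$ is a finite family $\{\mathcal C_i\}_{i\in X}$ of transformations from $A$ to $B$. Tests are closed under sequential composition, parallel composition $\otimes$ and coarse-graining (summing transformations over the blocks of a partition of $X$); identities $\mathcal I_A$ and swaps are one-outcome tests; systems and transformations form a strict symmetric monoidal category. Tests on $I$ are probability distributions, and numbers compose by multiplication. A state of $A$ is a transformation $I\to A$ (set $\mathsf{St}(A)$), an effect is a transformation $A\to I$ (set $\mathsf{Eff}(A)$), and $(a|\rho)\in[0,1]$ is their composition. States (effects) are equal iff they have the same pairing with all effects (states); transformations $\mathcal C,\mathcal C'$ from $A$ to $B$ are equal iff $(\mathcal C\otimes\mathcal I_S)\rho=(\mathcal C'\otimes\mathcal I_S)\rho$ for every system $S$ and every state $\rho$ of $AS$. The spanned real vector spaces are finite-dimensional; the sets of states, effects and transformations are closed (hence compact). $\mathcal T_n\to\mathcal T$ means $(E|(\mathcal T_n\otimes\mathcal I_S)|\rho)\to(E|(\mathcal T\otimes\mathcal I_S)|\rho)$ for all $S$, all states $\rho$ of $AS$, all effects $E$ of $BS$. A channel is a deterministic (one-outcome-test) transformation; it is reversible if it has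 an inverse channel; $G_A$ is the (compact) group of reversible channels on $A$. A transformation is pure if all its refinements (in tests containing it as a coarse-graining) are multiples of it. Causality: every system has a unique deterministic effect $u_A$. A state is normalised if $(u|\rho)=1$. The set of normalised states is convex. Microcanonical theories. A causal OPT is microcanonical if (1) for every system $A$ there is a unique $G_A$-invariant probability measure $\mathrm d\psi$ on the set of normalised pure states of $A$, and (2) writing $\chi_A:=\int\psi\,\mathrm d\psi$ for the microcanonical state of $A$, one has $\chi_{AB}=\chi_A\otimes\chi_B$ for all systems $A,B$. Operations. A channel $\mathcal B$ from $A$ to $A'$ is a basic noisy operation if there are systems $E,E'$ with $AE$ and $A'E'$ operationally equivalent (i.e. connected by a reversible channel) and a reversible channel $\mathcal U$ from $AE$ to $A'E'$ such that $\mathcal B=(\mathcal I_{A'}\otimes u_{E'})\,\mathcal U\,(\mathcal I_A\otimes\chi_E)$. A noisy operation is a limit of a sequence of basic noisy operations. A channel $\mathcal D$ from $A$ to $A'$ is unital if $\mathcal D\chi_A=\chi_{A'}$. *)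

theory Defs
  imports "HOL-Probability.Probability"
begin

section \<open>Operational probabilistic theories\<close>

text \<open>
  Systems are the elements of type \<open>'s\<close>, transformations live in type \<open>'t\<close>.
  \<open>Test A B X F\<close> says that the family \<open>F i\<close>, \<open>i \<in> X\<close>, is a test from \<open>A\<close> to \<open>B\<close>; the outcome
  sets \<open>X\<close> are finite sets of natural numbers (finite outcome sets up to labelling), and the values
  of \<open>F\<close> outside \<open>X\<close> are irrelevant. \<open>num\<close> reads a transformation of the trivial system as a number.
  Composition is written in the usual order: \<open>D \<odot> C\<close> is \<open>C\<close> followed by \<open>D\<close>.
\<close>

record ('s, 't) opt =
  triv  :: 's
  Comp  :: "'s \<Rightarrow> 's \<Rightarrow> 's"  (infixl "\<boxtimes>\<index>" 80)
  Tr    :: "'s \<Rightarrow> 's \<Rightarrow> 't set"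
  Test  :: "'s \<Rightarrow> 's \<Rightarrow> nat set \<Rightarrow> (nat \<Rightarrow> 't) \<Rightarrow> bool"
  Ident :: "'s \<Rightarrow> 't"
  Swap  :: "'s \<Rightarrow> 's \<Rightarrow> 't"
  Seq   :: "'t \<Rightarrow> 't \<Rightarrow> 't"  (infixl "\<odot>\<index>" 70)
  Par   :: "'t \<Rightarrow> 't \<Rightarrow> 't"  (infixl "\<otimes>\<index>" 75)
  num   :: "'t \<Rightarrow> real"

definition St :: "('s, 't) opt \<Rightarrow> 's \<Rightarrow> 't set" where
  "St T A = Tr T (triv T) A"

definition Eff :: "('s, 't) opt \<Rightarrow> 's \<Rightarrow> 't set" where
  "Eff T A = Tr T A (triv T)"

definition pairing :: "('s, 't) opt \<Rightarrow> 't \<Rightarrow> 't \<Rightarrow> real" where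
  "pairing T a \<rho> = num T (a \<odot>\<^bsub>T\<^esub> \<rho>)"

text \<open>The probability $(E | (C \otimes I_S) | \rho)$.\<close>

definition probe :: "('s, 't) opt \<Rightarrow> 's \<Rightarrow> 't \<Rightarrow> 't \<Rightarrow> 't \<Rightarrow> real" where
  "probe T S E \<rho> C = pairing T E ((C \<otimes>\<^bsub>T\<^esub> Ident T S) \<odot>\<^bsub>T\<^esub> \<rho>)"

text \<open>
  Transformations are determined by their probabilities \<open>probe\<close>, so the real vector space spanned
  by \<open>Tr T A B\<close> is a space of functions of \<open>(S, E, \<rho>)\<close>. Linear relations between
  transformations and limits of transformations are those of these functions.
\<close>

definition lin_comb :: "('s, 't) opt \<Rightarrow> 's \<Rightarrow> 's \<Rightarrow> 'i set \<Rightarrow> ('i \<Rightarrow> real) \<Rightarrow> ('i \<Rightarrow> 't) \<Rightarrow> 't \<Rightarrow> bool" where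
  "lin_comb T A B J c F C \<longleftrightarrow>
     (\<forall>S. \<forall>\<rho>\<in>St T (A \<boxtimes>\<^bsub>T\<^esub> S). \<forall>E\<in>Eff T (B \<boxtimes>\<^bsub>T\<^esub> S).
        probe T S E \<rho> C = (\<Sum>i\<in>J. c i * probe T S E \<rho> (F i)))"

abbreviation is_sum :: "('s, 't) opt \<Rightarrow> 's \<Rightarrow> 's \<Rightarrow> 'i set \<Rightarrow> ('i \<Rightarrow> 't) \<Rightarrow> 't \<Rightarrow> bool" where
  "is_sum T A B J F C \<equiv> lin_comb T A B J (\<lambda>_. 1) F C"

definition converges :: "('s, 't) opt \<Rightarrow> 's \<Rightarrow> 's \<Rightarrow> (nat \<Rightarrow> 't) \<Rightarrow> 't \<Rightarrow> bool" where
  "converges T A B F C \<longleftrightarrow>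
     (\<forall>S. \<forall>\<rho>\<in>St T (A \<boxtimes>\<^bsub>T\<^esub> S). \<forall>E\<in>Eff T (B \<boxtimes>\<^bsub>T\<^esub> S).
        (\<lambda>n. probe T S E \<rho> (F n)) \<longlonglongrightarrow> probe T S E \<rho> C)"

definition channel :: "('s, 't) opt \<Rightarrow> 's \<Rightarrow> 's \<Rightarrow> 't \<Rightarrow> bool" where
  "channel T A B C \<longleftrightarrow> Test T A B {0} (\<lambda>_. C)"

definition reversible :: "('s, 't) opt \<Rightarrow> 's \<Rightarrow> 's \<Rightarrow> 't \<Rightarrow> bool" where
  "reversible T A B U \<longleftrightarrow> channel T A B U \<and>
     (\<exists>V. channel T B A V \<and> V \<odot>\<^bsub>T\<^esub> U = Ident T A \<and> U \<odot>\<^bsub>T\<^esub> V = Ident T B)"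

text \<open>\<open>discard T A\<close> is the deterministic effect $u_A$ (unique in a causal theory).\<close>

definition discard :: "('s, 't) opt \<Rightarrow> 's \<Rightarrow> 't" where
  "discard T A = (THE u. channel T A (triv T) u)"

definition normalised :: "('s, 't) opt \<Rightarrow> 's \<Rightarrow> 't set" where
  "normalised T A = {\<rho> \<in> St T A. pairing T (discard T A) \<rho> = 1}"

definition pure :: "('s, 't) opt \<Rightarrow> 's \<Rightarrow> 's \<Rightarrow> 't \<Rightarrow> bool" where
  "pure T A B C \<longleftrightarrow> C \<in> Tr T A B \<and>
     (\<forall>X F J. Test T A B X F \<and> J \<subseteq> X \<and> is_sum T A B J F C \<longrightarrow>
        (\<forall>i\<in>J. \<exists>c. lin_comb T A B {()} (\<lambda>_. c) (\<lambda>_. C) (F i)))"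

locale strict_symmetric_monoidal =
  fixes T :: "('s, 't) opt" (structure)
  assumes comp_assoc: "(A \<boxtimes> B) \<boxtimes> C = A \<boxtimes> (B \<boxtimes> C)"
    and comp_triv: "A \<boxtimes> triv T = A" "triv T \<boxtimes> A = A"
    and Tr_disjoint: "f \<in> Tr T A B \<Longrightarrow> f \<in> Tr T A' B' \<Longrightarrow> A = A' \<and> B = B'"
    and Ident_in: "Ident T A \<in> Tr T A A"
    and Seq_in: "f \<in> Tr T A B \<Longrightarrow> g \<in> Tr T B C \<Longrightarrow> g \<odot> f \<in> Tr T A C"
    and Seq_assoc: "f \<in> Tr T A B \<Longrightarrow> g \<in> Tr T B C \<Longrightarrow> h \<in> Tr T C D \<Longrightarrow>
      (h \<odot> g) \<odot> f = h \<odot> (g \<odot> f)"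
    and Seq_Ident: "f \<in> Tr T A B \<Longrightarrow> f \<odot> Ident T A = f" "f \<in> Tr T A B \<Longrightarrow> Ident T B \<odot> f = f"
    and Par_in: "f \<in> Tr T A B \<Longrightarrow> g \<in> Tr T C D \<Longrightarrow> f \<otimes> g \<in> Tr T (A \<boxtimes> C) (B \<boxtimes> D)"
    and Par_Ident: "Ident T A \<otimes> Ident T B = Ident T (A \<boxtimes> B)"
    and Par_Seq: "f \<in> Tr T A B \<Longrightarrow> g \<in> Tr T B C \<Longrightarrow> f' \<in> Tr T A' B' \<Longrightarrow> g' \<in> Tr T B' C' \<Longrightarrow>
      (g \<odot> f) \<otimes> (g' \<odot> f') = (g \<otimes> g') \<odot> (f \<otimes> f')"
    and Par_assoc: "f \<in> Tr T A A' \<Longrightarrow> g \<in> Tr T B B' \<Longrightarrow> h \<in> Tr T C C' \<Longrightarrow>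
      (f \<otimes> g) \<otimes> h = f \<otimes> (g \<otimes> h)"
    and Par_triv: "f \<in> Tr T A B \<Longrightarrow> f \<otimes> Ident T (triv T) = f"
      "f \<in> Tr T A B \<Longrightarrow> Ident T (triv T) \<otimes> f = f"
    and Swap_in: "Swap T A B \<in> Tr T (A \<boxtimes> B) (B \<boxtimes> A)"
    and Swap_Swap: "Swap T B A \<odot> Swap T A B = Ident T (A \<boxtimes> B)"
    and Swap_natural: "f \<in> Tr T A A' \<Longrightarrow> g \<in> Tr T B B' \<Longrightarrow>
      Swap T A' B' \<odot> (f \<otimes> g) = (g \<otimes> f) \<odot> Swap T A B"
    and Swap_hexagon: "Swap T A (B \<boxtimes> C) = (Ident T B \<otimes> Swap T A C) \<odot> (Swap T A B \<otimes> Ident T C)"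

text \<open>
  Outcome sets of composite tests are encoded through \<open>prod_encode\<close>. A partition of the outcome
  set \<open>X\<close> is given by the fibres of a map \<open>h\<close>, so coarse-graining along an injective \<open>h\<close> is a
  relabelling of the outcomes.

  As states and effects are transformations with trivial input or output, \<open>finite_dim\<close> and
  \<open>Tr_closed\<close> cover them too. In \<open>Tr_closed\<close> the limit is not asked to lie in the span of
  \<open>Tr T A B\<close>: this is automatic because the span is finite-dimensional.
\<close>

locale opt_theory = strict_symmetric_monoidal T for T :: "('s, 't) opt" (structure) +
  assumes Test_finite: "Test T A B X F \<Longrightarrow> finite X"
    and Test_cong: "Test T A B X F \<Longrightarrow> (\<And>i. i \<in> X \<Longrightarrow> F i = G i) \<Longrightarrow> Test T A B X G"
    and Tr_iff_Test: "f \<in> Tr T A B \<longleftrightarrow> (\<exists>X F. Test T A B X F \<and> f \<in> F ` X)"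
    and Test_Ident: "Test T A A {0} (\<lambda>_. Ident T A)"
    and Test_Swap: "Test T (A \<boxtimes> B) (B \<boxtimes> A) {0} (\<lambda>_. Swap T A B)"
    and Test_Seq: "Test T A B X F \<Longrightarrow> Test T B C Y G \<Longrightarrow>
      Test T A C (prod_encode ` (X \<times> Y)) (\<lambda>k. case prod_decode k of (i, j) \<Rightarrow> G j \<odot> F i)"
    and Test_Par: "Test T A B X F \<Longrightarrow> Test T C D Y G \<Longrightarrow>
      Test T (A \<boxtimes> C) (B \<boxtimes> D) (prod_encode ` (X \<times> Y))
        (\<lambda>k. case prod_decode k of (i, j) \<Rightarrow> F i \<otimes> G j)"
    and Test_coarse_grain: "Test T A B X F \<Longrightarrow>
      \<exists>G. Test T A B (h ` X) G \<and> (\<forall>j\<in>h ` X. is_sum T A B {i \<in> X. h i = j} F (G j))"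
    and Test_triv: "Test T (triv T) (triv T) X F \<Longrightarrow>
      (\<forall>i\<in>X. 0 \<le> num T (F i)) \<and> (\<Sum>i\<in>X. num T (F i)) = 1"
    and num_inj: "inj_on (num T) (Tr T (triv T) (triv T))"
    and num_Seq: "p \<in> Tr T (triv T) (triv T) \<Longrightarrow> q \<in> Tr T (triv T) (triv T) \<Longrightarrow>
      num T (p \<odot> q) = num T p * num T q"
    and St_eqI: "\<rho> \<in> St T A \<Longrightarrow> \<sigma> \<in> St T A \<Longrightarrow>
      (\<And>a. a \<in> Eff T A \<Longrightarrow> pairing T a \<rho> = pairing T a \<sigma>) \<Longrightarrow> \<rho> = \<sigma>"
    and Eff_eqI: "a \<in> Eff T A \<Longrightarrow> b \<in> Eff T A \<Longrightarrow>
      (\<And>\<rho>. \<rho> \<in> St T A \<Longrightarrow> pairing T a \<rho> = pairing T b \<rho>) \<Longrightarrow> a = b"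
    and Tr_eqI: "f \<in> Tr T A B \<Longrightarrow> g \<in> Tr T A B \<Longrightarrow>
      (\<And>S \<rho>. \<rho> \<in> St T (A \<boxtimes> S) \<Longrightarrow> (f \<otimes> Ident T S) \<odot> \<rho> = (g \<otimes> Ident T S) \<odot> \<rho>) \<Longrightarrow> f = g"
    and finite_dim: "\<exists>K. finite K \<and> K \<subseteq> Tr T A B \<and>
      (\<forall>f\<in>Tr T A B. \<exists>c. lin_comb T A B K c (\<lambda>k. k) f)"
    and Tr_closed: "(\<And>n. F n \<in> Tr T A B) \<Longrightarrow>
      (\<And>S \<rho> E. \<rho> \<in> St T (A \<boxtimes> S) \<Longrightarrow> E \<in> Eff T (B \<boxtimes> S) \<Longrightarrow>
         convergent (\<lambda>n. probe T S E \<rho> (F n))) \<Longrightarrow>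
      \<exists>f\<in>Tr T A B. converges T A B F f"

locale causal_opt = opt_theory T for T :: "('s, 't) opt" (structure) +
  assumes causality: "\<exists>!u. channel T A (triv T) u"
    and normalised_convex: "\<rho> \<in> normalised T A \<Longrightarrow> \<sigma> \<in> normalised T A \<Longrightarrow> 0 \<le> p \<Longrightarrow> p \<le> 1 \<Longrightarrow>
      \<exists>\<tau>\<in>normalised T A. \<forall>a\<in>Eff T A.
        pairing T a \<tau> = p * pairing T a \<rho> + (1 - p) * pairing T a \<sigma>"


section \<open>Microcanonical theories\<close>

text \<open>
  The topology of the finite-dimensional space spanned by the states, restricted to \<open>St T A\<close>, is
  the coarsest one for which all effects are continuous, because effects separate states.
\<close>

definition state_topology :: "('s, 't) opt \<Rightarrow> 's \<Rightarrow> 't topology" where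
  "state_topology T A = topology_generated_by
     {{\<rho> \<in> St T A. pairing T a \<rho> \<in> U} | a U. a \<in> Eff T A \<and> open U}"

definition pure_states :: "('s, 't) opt \<Rightarrow> 's \<Rightarrow> 't set" where
  "pure_states T A = {\<psi> \<in> normalised T A. pure T (triv T) A \<psi>}"

definition pure_borel :: "('s, 't) opt \<Rightarrow> 's \<Rightarrow> 't measure" where
  "pure_borel T A = sigma (pure_states T A)
     {V. openin (subtopology (state_topology T A) (pure_states T A)) V}"

definition invariant_measure :: "('s, 't) opt \<Rightarrow> 's \<Rightarrow> 't measure \<Rightarrow> bool" where
  "invariant_measure T A \<mu> \<longleftrightarrow> prob_space \<mu> \<and> sets \<mu> = sets (pure_borel T A) \<and>
     (\<forall>U. reversible T A A U \<longrightarrow> distr \<mu> (pure_borel T A) (\<lambda>\<psi>. U \<odot>\<^bsub>T\<^esub> \<psi>) = \<mu>)"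

definition micro_measure :: "('s, 't) opt \<Rightarrow> 's \<Rightarrow> 't measure" where
  "micro_measure T A = (THE \<mu>. invariant_measure T A \<mu>)"

text \<open>
  The integral $\chi_A = \int \psi \, d\psi$ is taken in the space spanned by the states, where the
  effects are a separating family of linear functionals.
\<close>

definition micro_state :: "('s, 't) opt \<Rightarrow> 's \<Rightarrow> 't" where
  "micro_state T A = (THE \<omega>. \<omega> \<in> St T A \<and>
     (\<forall>a\<in>Eff T A. pairing T a \<omega> = (\<integral>\<psi>. pairing T a \<psi> \<partial>micro_measure T A)))"

locale microcanonical_theory = causal_opt T for T :: "('s, 't) opt" (structure) +
  assumes ex1_invariant_measure: "\<exists>!\<mu>. invariant_measure T A \<mu>"
    and micro_state_Comp: "micro_state T (A \<boxtimes> B) = micro_state T A \<otimes> micro_state T B"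


section \<open>Noisy and unital operations\<close>

text \<open>The existence of \<open>U\<close> says in particular that \<open>AE\<close> and \<open>A'E'\<close> are operationally equivalent.\<close>

definition basic_noisy :: "('s, 't) opt \<Rightarrow> 's \<Rightarrow> 's \<Rightarrow> 't \<Rightarrow> bool" where
  "basic_noisy T A A' B \<longleftrightarrow> channel T A A' B \<and>
     (\<exists>E E' U. reversible T (A \<boxtimes>\<^bsub>T\<^esub> E) (A' \<boxtimes>\<^bsub>T\<^esub> E') U \<and>
        B = (Ident T A' \<otimes>\<^bsub>T\<^esub> discard T E') \<odot>\<^bsub>T\<^esub> U \<odot>\<^bsub>T\<^esub> (Ident T A \<otimes>\<^bsub>T\<^esub> micro_state T E))"

definition noisy_operation :: "('s, 't) opt \<Rightarrow> 's \<Rightarrow> 's \<Rightarrow> 't \<Rightarrow> bool" where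
  "noisy_operation T A A' N \<longleftrightarrow> N \<in> Tr T A A' \<and>
     (\<exists>B. (\<forall>n. basic_noisy T A A' (B n)) \<and> converges T A A' B N)"

definition unital :: "('s, 't) opt \<Rightarrow> 's \<Rightarrow> 's \<Rightarrow> 't \<Rightarrow> bool" where
  "unital T A A' D \<longleftrightarrow> channel T A A' D \<and> D \<odot>\<^bsub>T\<^esub> micro_state T A = micro_state T A'"

end

theory Submission
  imports Defs
begin

text \<open>
  A reversible channel \<open>U\<close> from \<open>A\<close> to \<open>B\<close> maps pure states to pure states and conjugates \<open>G_A\<close> to \<open>G_B\<close>,
  so it pushes the invariant measure of \<open>A\<close> forward to an invariant measure of \<open>B\<close>; by uniqueness,
  \<open>U \<chi>_A = \<chi>_B\<close>. Together with \<open>\<chi>_{AE} = \<chi>_A \<otimes> \<chi>_E\<close> this makes every basic noisy operation unital,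
  and the equation \<open>N \<chi>_A = \<chi>_{A'}\<close> passes to limits. Two points remain. The integral
  defining \<open>\<chi>_A\<close> has to be an actual state, which follows from convexity and compactness of the
  normalised states. A limit of channels has to be a channel: it preserves the deterministic
  effect, and by causality this forces it to be a one-outcome test.
\<close>

text \<open>Bolzano-Weierstrass one coordinate at a time: each new member of the family refines the
  subsequence already chosen, and refining preserves the convergence obtained before.\<close>

lemma convergent_subseq_finite_family:
  fixes g :: "'k \<Rightarrow> nat \<Rightarrow> real"
  assumes "finite K" and "\<And>k n. k \<in> K \<Longrightarrow> g k n \<in> {l..u}"
  shows "\<exists>r. strict_mono r \<and> (\<forall>k\<in>K. convergent (\<lambda>n. g k (r n)))"
  using assms
proof (induction K rule: finite_induct)
  case empty
  show ?case by (intro exI[of _ id]) (auto simp: strict_mono_def)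
next
  case (insert k K)
  then obtain r where r: "strict_mono r" "\<forall>k\<in>K. convergent (\<lambda>n. g k (r n))"
    by auto
  have "\<forall>n. (g k \<circ> r) n \<in> {l..u}"
    using insert.prems by auto
  then obtain s x where s: "strict_mono s" "((g k \<circ> r) \<circ> s) \<longlonglongrightarrow> x"
    using compact_Icc[of l u] unfolding compact_def by metis
  show ?case
  proof (intro exI[of _ "r \<circ> s"] conjI ballI)
    show "strict_mono (r \<circ> s)"
      using r(1) s(1) by (rule strict_mono_o)
    fix j assume "j \<in> insert k K"
    then show "convergent (\<lambda>n. g j ((r \<circ> s) n))"
    proof
      assume "j = k"
      with s(2) show ?thesis
        by (auto simp: convergent_def o_def)
    next
      assume "j \<in> K"
      with r(2) have "convergent (\<lambda>n. g j (r n))" by auto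
      from convergent_subseq_convergent[OF this s(1)] show ?thesis
        by (simp add: o_def)
    qed
  qed
qed

section \<open>Channels and probabilities\<close>

context opt_theory
begin

section \<open>Channels and reversible channels under composition\<close>

lemma channel_in_Tr: "channel T A B C \<Longrightarrow> C \<in> Tr T A B"
  unfolding channel_def Tr_iff_Test by blast

lemma reversible_in_Tr: "reversible T A B U \<Longrightarrow> U \<in> Tr T A B"
  unfolding reversible_def by (blast intro: channel_in_Tr)

lemma channel_Ident: "channel T A A (Ident T A)"
  unfolding channel_def by (rule Test_Ident)

text \<open>\<open>channel\<close> fixes the outcome label 0, whereas composite tests carry encoded
  pairs of labels; this equation makes composites of channels channels without relabelling.\<close>

lemma prod_encode_0: "prod_encode (0, 0) = 0"
  by (simp add: prod_encode_def)

lemma channel_Seq: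
  assumes "channel T A B C" "channel T B B' D"
  shows "channel T A B' (D \<odot> C)"
proof -
  have "Test T A B' {0} (\<lambda>k. case prod_decode k of (i, j) \<Rightarrow> D \<odot> C)"
    using Test_Seq[OF assms[unfolded channel_def]] by (simp add: prod_encode_0)
  then show ?thesis
    unfolding channel_def by (rule Test_cong) (auto split: prod.split)
qed

lemma channel_Par:
  assumes "channel T A B C" "channel T A' B' D"
  shows "channel T (A \<boxtimes> A') (B \<boxtimes> B') (C \<otimes> D)"
proof -
  have "Test T (A \<boxtimes> A') (B \<boxtimes> B') {0} (\<lambda>k. case prod_decode k of (i, j) \<Rightarrow> C \<otimes> D)"
    using Test_Par[OF assms[unfolded channel_def]] by (simp add: prod_encode_0)
  then show ?thesis
    unfolding channel_def by (rule Test_cong) (auto split: prod.split)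
qed

lemma reversible_Seq:
  assumes "reversible T A B U" "reversible T B C W"
  shows "reversible T A C (W \<odot> U)"
proof -
  obtain V where V: "channel T B A V" "V \<odot> U = Ident T A" "U \<odot> V = Ident T B"
    using assms(1) unfolding reversible_def by auto
  obtain X where X: "channel T C B X" "X \<odot> W = Ident T B" "W \<odot> X = Ident T C"
    using assms(2) unfolding reversible_def by auto
  note [intro] = channel_in_Tr Seq_in
  have U: "U \<in> Tr T A B" and W: "W \<in> Tr T B C" and V': "V \<in> Tr T B A" and X': "X \<in> Tr T C B"
    using assms V X by (auto simp: reversible_def)
  have "(V \<odot> X) \<odot> (W \<odot> U) = V \<odot> ((X \<odot> W) \<odot> U)"
    using Seq_assoc[of "W \<odot> U" A C X B V A] Seq_assoc[of U A B W C X B] U W V' X' by auto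
  also have "\<dots> = Ident T A"
    using V X U by (simp add: Seq_Ident)
  finally have 1: "(V \<odot> X) \<odot> (W \<odot> U) = Ident T A" .
  have "(W \<odot> U) \<odot> (V \<odot> X) = W \<odot> ((U \<odot> V) \<odot> X)"
    using Seq_assoc[of "V \<odot> X" C A U B W C] Seq_assoc[of X C B V A U B] U W V' X' by auto
  also have "\<dots> = Ident T C"
    using V X X' by (simp add: Seq_Ident)
  finally have 2: "(W \<odot> U) \<odot> (V \<odot> X) = Ident T C" .
  show ?thesis
    unfolding reversible_def
    using 1 2 assms V(1) X(1) by (auto simp: reversible_def intro: channel_Seq)
qed

section \<open>Probabilities and the pairing of states with effects\<close>

lemma num_bounds:
  assumes "p \<in> Tr T (triv T) (triv T)"
  shows "0 \<le> num T p" "num T p \<le> 1"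
proof -
  obtain X F where F: "Test T (triv T) (triv T) X F" "p \<in> F ` X"
    using assms unfolding Tr_iff_Test by blast
  then obtain i where i: "i \<in> X" "p = F i" by auto
  have "num T (F i) \<le> (\<Sum>i\<in>X. num T (F i))"
    using Test_triv[OF F(1)] Test_finite[OF F(1)] i(1) by (intro member_le_sum) auto
  then show "0 \<le> num T p" "num T p \<le> 1"
    using Test_triv[OF F(1)] i by auto
qed

lemma num_channel: "channel T (triv T) (triv T) p \<Longrightarrow> num T p = 1"
  unfolding channel_def using Test_triv by fastforce

text \<open>The identity also has number 1, and \<open>num\<close> is injective. This removes the
  scalar left over when a normalised state is discarded.\<close>

lemma num_eq_1_imp_Ident:
  assumes "p \<in> Tr T (triv T) (triv T)" "num T p = 1"
  shows "p = Ident T (triv T)"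
  using inj_onD[OF num_inj _ assms(1) Ident_in] assms(2) num_channel[OF channel_Ident] by simp

lemma pairing_in_Tr:
  "a \<in> Eff T A \<Longrightarrow> \<rho> \<in> St T A \<Longrightarrow> a \<odot> \<rho> \<in> Tr T (triv T) (triv T)"
  unfolding Eff_def St_def by (blast intro: Seq_in)

lemma pairing_nonneg: "a \<in> Eff T A \<Longrightarrow> \<rho> \<in> St T A \<Longrightarrow> 0 \<le> pairing T a \<rho>"
  and pairing_le_1: "a \<in> Eff T A \<Longrightarrow> \<rho> \<in> St T A \<Longrightarrow> pairing T a \<rho> \<le> 1"
  unfolding pairing_def by (auto intro: num_bounds pairing_in_Tr)

lemma Seq_St: "f \<in> Tr T A B \<Longrightarrow> \<rho> \<in> St T A \<Longrightarrow> f \<odot> \<rho> \<in> St T B"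
  and Seq_Eff: "f \<in> Tr T A B \<Longrightarrow> a \<in> Eff T B \<Longrightarrow> a \<odot> f \<in> Eff T A"
  unfolding St_def Eff_def by (auto intro: Seq_in)

lemma pairing_Seq:
  "f \<in> Tr T A B \<Longrightarrow> \<rho> \<in> St T A \<Longrightarrow> a \<in> Eff T B \<Longrightarrow> pairing T a (f \<odot> \<rho>) = pairing T (a \<odot> f) \<rho>"
  unfolding pairing_def St_def Eff_def by (simp add: Seq_assoc)

section \<open>Probing with an ancilla\<close>

lemma probe_state_in:
  "C \<in> Tr T A B \<Longrightarrow> \<rho> \<in> St T (A \<boxtimes> S) \<Longrightarrow> (C \<otimes> Ident T S) \<odot> \<rho> \<in> St T (B \<boxtimes> S)"
  by (rule Seq_St[OF Par_in[OF _ Ident_in]])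

lemma probe_triv:
  "C \<in> Tr T A B \<Longrightarrow> probe T (triv T) E \<rho> C = pairing T E (C \<odot> \<rho>)"
  unfolding probe_def by (simp add: Par_triv)

lemma Ident_in_St: "Ident T (triv T) \<in> St T (triv T)"
  and Ident_in_Eff: "Ident T (triv T) \<in> Eff T (triv T)"
  by (simp_all add: St_def Eff_def Ident_in)

lemma probe_Ident_state:
  "\<rho> \<in> St T A \<Longrightarrow> probe T (triv T) a (Ident T (triv T)) \<rho> = pairing T a \<rho>"
  by (simp add: St_def probe_triv Seq_Ident)

lemma probe_Ident_effect:
  assumes "a \<in> Eff T A" "\<rho> \<in> St T A"
  shows "probe T (triv T) (Ident T (triv T)) \<rho> a = pairing T a \<rho>"
  using assms Seq_Ident(2)[OF pairing_in_Tr[OF assms]]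
  by (simp add: Eff_def probe_triv pairing_def)

text \<open>A state has trivial input, so the ancilla state \<open>\<rho>\<close> stays in a product
  with \<open>f\<close> and can be absorbed into the effect. Relations and limits of states can
  therefore be tested by effects on \<open>A\<close> alone.\<close>

lemma probe_state:
  assumes f: "f \<in> St T A" and \<rho>: "\<rho> \<in> St T S" and E: "E \<in> Eff T (A \<boxtimes> S)"
  shows "probe T S E \<rho> f = pairing T (E \<odot> (Ident T A \<otimes> \<rho>)) f"
    and "E \<odot> (Ident T A \<otimes> \<rho>) \<in> Eff T A"
proof -
  have f': "f \<in> Tr T (triv T) A" and \<rho>': "\<rho> \<in> Tr T (triv T) S"
    using f \<rho> by (auto simp: St_def)
  have I\<rho>: "Ident T A \<otimes> \<rho> \<in> Tr T A (A \<boxtimes> S)"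
    using Par_in[OF Ident_in \<rho>', of A] by (simp add: comp_triv)
  then show "E \<odot> (Ident T A \<otimes> \<rho>) \<in> Eff T A"
    using E by (rule Seq_Eff)
  \<comment> \<open>Interchange law used twice: both orders of applying \<open>f\<close> and
    \<open>\<rho>\<close> equal \<open>f \<otimes> \<rho>\<close>.\<close>
  have "(f \<otimes> Ident T S) \<odot> \<rho> = (f \<otimes> Ident T S) \<odot> (Ident T (triv T) \<otimes> \<rho>)"
    using \<rho>' by (simp add: Par_triv)
  also have "\<dots> = (f \<odot> Ident T (triv T)) \<otimes> (Ident T S \<odot> \<rho>)"
    by (rule Par_Seq[OF Ident_in f' \<rho>' Ident_in, symmetric])
  also have "\<dots> = (Ident T A \<odot> f) \<otimes> (\<rho> \<odot> Ident T (triv T))"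
    using f' \<rho>' by (simp add: Seq_Ident)
  also have "\<dots> = (Ident T A \<otimes> \<rho>) \<odot> (f \<otimes> Ident T (triv T))"
    by (rule Par_Seq[OF f' Ident_in Ident_in \<rho>'])
  also have "\<dots> = (Ident T A \<otimes> \<rho>) \<odot> f"
    using f' by (simp add: Par_triv)
  finally show "probe T S E \<rho> f = pairing T (E \<odot> (Ident T A \<otimes> \<rho>)) f"
    using pairing_Seq[OF I\<rho> f E] by (simp add: probe_def)
qed

text \<open>One direction takes a trivial ancilla; the other absorbs the ancilla by
  \<open>probe_state\<close>.\<close>

lemma lin_comb_state_iff:
  assumes C: "C \<in> St T A" and F: "\<And>i. i \<in> J \<Longrightarrow> F i \<in> St T A"
  shows "lin_comb T (triv T) A J c F C \<longleftrightarrow>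
    (\<forall>a\<in>Eff T A. pairing T a C = (\<Sum>i\<in>J. c i * pairing T a (F i)))"
proof
  assume L: "lin_comb T (triv T) A J c F C"
  show "\<forall>a\<in>Eff T A. pairing T a C = (\<Sum>i\<in>J. c i * pairing T a (F i))"
  proof
    fix a assume "a \<in> Eff T A"
    with L Ident_in_St have "probe T (triv T) a (Ident T (triv T)) C =
        (\<Sum>i\<in>J. c i * probe T (triv T) a (Ident T (triv T)) (F i))"
      unfolding lin_comb_def by (simp add: comp_triv)
    then show "pairing T a C = (\<Sum>i\<in>J. c i * pairing T a (F i))"
      using C F by (simp add: probe_Ident_state[where A = A])
  qed
next
  assume P: "\<forall>a\<in>Eff T A. pairing T a C = (\<Sum>i\<in>J. c i * pairing T a (F i))"
  show "lin_comb T (triv T) A J c F C"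
    unfolding lin_comb_def
  proof (intro allI ballI)
    fix S \<rho> E assume "\<rho> \<in> St T (triv T \<boxtimes> S)" and E: "E \<in> Eff T (A \<boxtimes> S)"
    then have \<rho>: "\<rho> \<in> St T S" by (simp add: comp_triv)
    show "probe T S E \<rho> C = (\<Sum>i\<in>J. c i * probe T S E \<rho> (F i))"
      using P probe_state(2)[OF C \<rho> E] by (simp add: probe_state(1)[OF _ \<rho> E] C F)
  qed
qed

text \<open>Finite dimension in usable form: the pairings with \<open>K\<close> are finitely many
  coordinates that determine all probabilities of a state.\<close>

lemma Eff_finite_span:
  obtains K where "finite K" "K \<subseteq> Eff T A"
    "\<And>a. a \<in> Eff T A \<Longrightarrow> \<exists>c. \<forall>\<rho>\<in>St T A. pairing T a \<rho> = (\<Sum>k\<in>K. c k * pairing T k \<rho>)"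
proof -
  obtain K where K: "finite K" "K \<subseteq> Eff T A"
    "\<And>a. a \<in> Eff T A \<Longrightarrow> \<exists>c. lin_comb T A (triv T) K c (\<lambda>k. k) a"
    using finite_dim[of A "triv T"] unfolding Eff_def by blast
  show ?thesis
  proof (rule that[OF K(1,2)])
    fix a assume a: "a \<in> Eff T A"
    then obtain c where c: "lin_comb T A (triv T) K c (\<lambda>k. k) a" using K(3) by blast
    have "pairing T a \<rho> = (\<Sum>k\<in>K. c k * pairing T k \<rho>)" if \<rho>: "\<rho> \<in> St T A" for \<rho>
    proof -
      have "probe T (triv T) (Ident T (triv T)) \<rho> a =
          (\<Sum>k\<in>K. c k * probe T (triv T) (Ident T (triv T)) \<rho> k)"
        using c \<rho> Ident_in_Eff unfolding lin_comb_def by (simp add: comp_triv)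
      also have "\<dots> = (\<Sum>k\<in>K. c k * pairing T k \<rho>)"
        using K(2) \<rho> by (intro sum.cong) (auto simp: probe_Ident_effect[where A = A])
      finally show ?thesis using a \<rho> by (simp add: probe_Ident_effect[where A = A])
    qed
    then show "\<exists>c. \<forall>\<rho>\<in>St T A. pairing T a \<rho> = (\<Sum>k\<in>K. c k * pairing T k \<rho>)" by blast
  qed
qed

text \<open>Coarse-graining along the constant map 0 merges all outcomes; nonemptiness of
  \<open>X\<close> makes the image exactly \<open>{0}\<close>.\<close>

lemma Test_total_channel:
  assumes F: "Test T A B X F" and X: "X \<noteq> {}"
  obtains G where "channel T A B G" "is_sum T A B X F G"
proof -
  from X have img: "(\<lambda>_. 0) ` X = {0::nat}" by auto
  obtain G where "Test T A B {0} G" "is_sum T A B {i \<in> X. (0::nat) = 0} F (G 0)"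
    using Test_coarse_grain[OF F, of "\<lambda>_. 0"] unfolding img by auto
  moreover have "Test T A B {0} (\<lambda>_. G 0)"
    using calculation(1) by (rule Test_cong) auto
  ultimately show ?thesis
    using that[of "G 0"] unfolding channel_def by simp
qed

end

section \<open>Deterministic effects\<close>

context causal_opt
begin

lemma channel_discard: "channel T A (triv T) (discard T A)"
  unfolding discard_def by (rule theI'[OF causality])

lemma discard_in_Eff: "discard T A \<in> Eff T A"
  using channel_in_Tr[OF channel_discard] by (simp add: Eff_def)

lemma discard_eqI: "channel T A (triv T) u \<Longrightarrow> u = discard T A"
  using causality channel_discard by blast

lemma discard_channel: "channel T A B C \<Longrightarrow> discard T B \<odot> C = discard T A"
  by (rule discard_eqI[OF channel_Seq[OF _ channel_discard]])

text \<open>\<open>C \<otimes> Ident T S\<close> is again a channel, and by causality the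
  deterministic effect absorbs it.\<close>

lemma probe_discard_channel:
  assumes C: "channel T A B C" and \<rho>: "\<rho> \<in> St T (A \<boxtimes> S)"
  shows "probe T S (discard T (B \<boxtimes> S)) \<rho> C = pairing T (discard T (A \<boxtimes> S)) \<rho>"
proof -
  have CI: "channel T (A \<boxtimes> S) (B \<boxtimes> S) (C \<otimes> Ident T S)"
    by (rule channel_Par[OF C channel_Ident])
  show ?thesis
    unfolding probe_def
    using pairing_Seq[OF channel_in_Tr[OF CI] \<rho> discard_in_Eff] discard_channel[OF CI] by simp
qed

text \<open>The effect belongs to a test whose total is a deterministic effect, hence
  \<open>discard T A\<close>; the other outcomes contribute nonnegative amounts.\<close>

lemma pairing_le_discard:
  assumes a: "a \<in> Eff T A" and \<rho>: "\<rho> \<in> St T A"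
  shows "pairing T a \<rho> \<le> pairing T (discard T A) \<rho>"
proof -
  obtain X F where F: "Test T A (triv T) X F" "a \<in> F ` X"
    using a unfolding Eff_def Tr_iff_Test by blast
  then obtain i where i: "i \<in> X" "a = F i" by auto
  obtain G where G: "channel T A (triv T) G" "is_sum T A (triv T) X F G"
    using Test_total_channel[OF F(1)] i by blast
  have Fin: "F j \<in> Eff T A" if "j \<in> X" for j
    using F(1) that unfolding Eff_def Tr_iff_Test by blast
  have GE: "G \<in> Eff T A" using channel_in_Tr[OF G(1)] by (simp add: Eff_def)
  have "pairing T a \<rho> \<le> (\<Sum>j\<in>X. pairing T (F j) \<rho>)"
    unfolding i(2) using i(1) Test_finite[OF F(1)] Fin \<rho>
    by (intro member_le_sum) (auto intro: pairing_nonneg)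
  also have "\<dots> = (\<Sum>j\<in>X. probe T (triv T) (Ident T (triv T)) \<rho> (F j))"
    using Fin \<rho> by (simp add: probe_Ident_effect[where A = A])
  also have "\<dots> = pairing T G \<rho>"
    using G(2) \<rho> Ident_in_Eff probe_Ident_effect[OF GE \<rho>]
    unfolding lin_comb_def by (simp add: comp_triv)
  finally show ?thesis using discard_eqI[OF G(1)] by simp
qed

text \<open>
  In a test containing \<open>N\<close>, the other outcomes have total probability zero, so \<open>N\<close> equals the channel
  obtained by summing the whole test.
\<close>

lemma channel_if_discard_preserving:
  assumes N: "N \<in> Tr T A B"
    and preserve: "\<And>S \<rho>. \<rho> \<in> St T (A \<boxtimes> S) \<Longrightarrow>
      probe T S (discard T (B \<boxtimes> S)) \<rho> N = pairing T (discard T (A \<boxtimes> S)) \<rho>"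
  shows "channel T A B N"
proof -
  obtain X F where F: "Test T A B X F" "N \<in> F ` X"
    using N unfolding Tr_iff_Test by blast
  then obtain i where i: "i \<in> X" "N = F i" by auto
  obtain G where G: "channel T A B G" "is_sum T A B X F G"
    using Test_total_channel[OF F(1)] i by blast
  have fin: "finite X" using Test_finite[OF F(1)] .
  have Fin: "F j \<in> Tr T A B" if "j \<in> X" for j
    using F(1) that unfolding Tr_iff_Test by blast
  have Gin: "G \<in> Tr T A B" by (rule channel_in_Tr[OF G(1)])
  have split: "probe T S E \<rho> G = probe T S E \<rho> N + (\<Sum>j\<in>X - {i}. probe T S E \<rho> (F j))"
    if "\<rho> \<in> St T (A \<boxtimes> S)" "E \<in> Eff T (B \<boxtimes> S)" for S E \<rho>
    using G(2) that fin i unfolding lin_comb_def by (simp add: sum.remove)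
  have "G = N"
  proof (rule Tr_eqI[OF Gin N])
    fix S \<rho> assume \<rho>: "\<rho> \<in> St T (A \<boxtimes> S)"
    note st = probe_state_in[OF _ \<rho>]
    have "(\<Sum>j\<in>X - {i}. probe T S (discard T (B \<boxtimes> S)) \<rho> (F j)) = 0"
      using split[OF \<rho> discard_in_Eff] preserve[OF \<rho>] probe_discard_channel[OF G(1) \<rho>] by simp
    then have z: "probe T S (discard T (B \<boxtimes> S)) \<rho> (F j) = 0" if "j \<in> X - {i}" for j
      using that fin
      by (subst (asm) sum_nonneg_eq_0_iff)
        (auto simp: probe_def intro!: pairing_nonneg[OF discard_in_Eff] st Fin)
    show "(G \<otimes> Ident T S) \<odot> \<rho> = (N \<otimes> Ident T S) \<odot> \<rho>"
    proof (rule St_eqI[OF st[OF Gin] st[OF N]])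
      fix E assume E: "E \<in> Eff T (B \<boxtimes> S)"
      \<comment> \<open>Every effect is dominated by the deterministic one, so vanishing under
        \<open>discard\<close> gives vanishing under \<open>E\<close>.\<close>
      have "probe T S E \<rho> (F j) = 0" if "j \<in> X - {i}" for j
        using z[OF that] pairing_le_discard[OF E st[OF Fin]] pairing_nonneg[OF E st[OF Fin]] that
        by (force simp: probe_def)
      then show "pairing T E ((G \<otimes> Ident T S) \<odot> \<rho>) = pairing T E ((N \<otimes> Ident T S) \<odot> \<rho>)"
        using split[OF \<rho> E] by (simp add: probe_def)
    qed
  qed
  with G(1) show ?thesis by simp
qed

text \<open>Under the deterministic effect the probabilities of the \<open>C n\<close> do not depend
  on \<open>n\<close>, so the limit inherits their common value.\<close>

lemma channel_limit:
  assumes N: "N \<in> Tr T A B" and C: "\<And>n. channel T A B (C n)" and lim: "converges T A B C N"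
  shows "channel T A B N"
proof (rule channel_if_discard_preserving[OF N])
  fix S \<rho> assume \<rho>: "\<rho> \<in> St T (A \<boxtimes> S)"
  have "(\<lambda>n. probe T S (discard T (B \<boxtimes> S)) \<rho> (C n)) \<longlonglongrightarrow> probe T S (discard T (B \<boxtimes> S)) \<rho> N"
    using lim \<rho> discard_in_Eff unfolding converges_def by blast
  then show "probe T S (discard T (B \<boxtimes> S)) \<rho> N = pairing T (discard T (A \<boxtimes> S)) \<rho>"
    using probe_discard_channel[OF C \<rho>] by (simp add: LIMSEQ_const_iff)
qed

section \<open>Barycentres of normalised states\<close>

text \<open>Finitely many coordinates in [0,1] have a convergent subsequence, linearity extends
  convergence to all effects, and closedness of the set of states supplies the limit.\<close>

lemma normalised_seq_compact:
  fixes F :: "nat \<Rightarrow> 't"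
  assumes F: "\<And>n. F n \<in> normalised T A"
  obtains r \<rho> where "strict_mono r" "\<rho> \<in> normalised T A"
    "\<And>a. a \<in> Eff T A \<Longrightarrow> (\<lambda>n. pairing T a (F (r n))) \<longlonglongrightarrow> pairing T a \<rho>"
proof -
  obtain K where K: "finite K" "K \<subseteq> Eff T A"
    "\<And>a. a \<in> Eff T A \<Longrightarrow> \<exists>c. \<forall>\<rho>\<in>St T A. pairing T a \<rho> = (\<Sum>k\<in>K. c k * pairing T k \<rho>)"
    by (rule Eff_finite_span[of A]) blast
  have FS: "F n \<in> St T A" for n using F unfolding normalised_def by blast
  have "pairing T k (F n) \<in> {0..1}" if "k \<in> K" for k n
    using that K(2) FS by (auto intro: pairing_nonneg pairing_le_1)
  from convergent_subseq_finite_family[of K "\<lambda>k n. pairing T k (F n)", OF K(1) this]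
  obtain r where r: "strict_mono r" "\<And>k. k \<in> K \<Longrightarrow> convergent (\<lambda>n. pairing T k (F (r n)))"
    by blast
  have conv: "convergent (\<lambda>n. pairing T a (F (r n)))" if a: "a \<in> Eff T A" for a
  proof -
    from K(3)[OF a] obtain c
      where "\<And>\<rho>. \<rho> \<in> St T A \<Longrightarrow> pairing T a \<rho> = (\<Sum>k\<in>K. c k * pairing T k \<rho>)" by blast
    then have "(\<lambda>n. pairing T a (F (r n))) = (\<lambda>n. \<Sum>k\<in>K. c k * pairing T k (F (r n)))"
      using FS by auto
    then show ?thesis
      using r(2) by (auto intro!: convergent_sum convergent_mult convergent_const)
  qed
  \<comment> \<open>Closedness asks for convergence of all probes with ancillas;
    \<open>probe_state\<close> reduces these to pairings.\<close>
  have "\<exists>f\<in>Tr T (triv T) A. converges T (triv T) A (\<lambda>n. F (r n)) f"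
  proof (rule Tr_closed)
    show "F (r n) \<in> Tr T (triv T) A" for n using FS by (simp add: St_def)
    fix S \<rho> E assume "\<rho> \<in> St T (triv T \<boxtimes> S)" "E \<in> Eff T (A \<boxtimes> S)"
    then show "convergent (\<lambda>n. probe T S E \<rho> (F (r n)))"
      using conv probe_state[OF FS, of \<rho> S E] by (simp add: comp_triv)
  qed
  then obtain \<rho> where \<rho>: "\<rho> \<in> St T A" "converges T (triv T) A (\<lambda>n. F (r n)) \<rho>"
    unfolding St_def by blast
  have lim: "(\<lambda>n. pairing T a (F (r n))) \<longlonglongrightarrow> pairing T a \<rho>" if "a \<in> Eff T A" for a
  proof -
    have "(\<lambda>n. probe T (triv T) a (Ident T (triv T)) (F (r n)))
        \<longlonglongrightarrow> probe T (triv T) a (Ident T (triv T)) \<rho>"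
      using \<rho>(2) that Ident_in_St unfolding converges_def by (simp add: comp_triv)
    then show ?thesis using FS \<rho>(1) by (simp add: probe_Ident_state[where A = A])
  qed
  \<comment> \<open>The pairing with the deterministic effect is constantly 1 along the
    sequence.\<close>
  have "\<rho> \<in> normalised T A"
    using lim[OF discard_in_Eff] F \<rho>(1) by (auto simp: normalised_def LIMSEQ_const_iff)
  with that r(1) lim show ?thesis by blast
qed

text \<open>
  The barycentre is found as the normalised state closest to the vector \<open>m\<close> of averages: integrating
  the first-order condition at the minimiser over \<open>M\<close> forces the distance to vanish.
\<close>

lemma barycentre_exists:
  assumes "prob_space M"
    and f: "\<And>x. x \<in> space M \<Longrightarrow> f x \<in> normalised T A"
    and meas: "\<And>a. a \<in> Eff T A \<Longrightarrow> (\<lambda>x. pairing T a (f x)) \<in> borel_measurable M"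
  obtains \<omega> where "\<omega> \<in> normalised T A"
    "\<And>a. a \<in> Eff T A \<Longrightarrow> pairing T a \<omega> = (\<integral>x. pairing T a (f x) \<partial>M)"
proof -
  interpret M: prob_space M by fact
  obtain K where K: "finite K" "K \<subseteq> Eff T A"
    "\<And>a. a \<in> Eff T A \<Longrightarrow> \<exists>c. \<forall>\<rho>\<in>St T A. pairing T a \<rho> = (\<Sum>k\<in>K. c k * pairing T k \<rho>)"
    by (rule Eff_finite_span[of A]) blast
  have St: "\<rho> \<in> St T A" if "\<rho> \<in> normalised T A" for \<rho>
    using that unfolding normalised_def by blast
  have int: "integrable M (\<lambda>x. pairing T a (f x))" if "a \<in> Eff T A" for a
    using meas[OF that] f St that
    by (intro M.integrable_const_bound[where B=1] AE_I2)
      (auto simp: abs_le_iff intro: pairing_le_1 order_trans[OF _ pairing_nonneg])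
  define m where "m k = (\<integral>x. pairing T k (f x) \<partial>M)" for k
  \<comment> \<open>\<open>d\<close> is the squared Euclidean distance to \<open>m\<close> in the
    coordinates \<open>K\<close>; \<open>I\<close> will be its infimum, approached by the sequence
    \<open>F\<close>.\<close>
  define d where "d \<rho> = (\<Sum>k\<in>K. (pairing T k \<rho> - m k)\<^sup>2)" for \<rho>
  define I where "I = (INF \<rho>\<in>normalised T A. d \<rho>)"
  have ne: "normalised T A \<noteq> {}"
    using f M.not_empty by blast
  have bdd: "bdd_below (d ` normalised T A)"
    by (intro bdd_belowI[of _ 0]) (auto simp: d_def intro: sum_nonneg)
  have "\<exists>\<rho>\<in>normalised T A. d \<rho> < I + 1 / real (Suc n)" for n
    using cInf_lessD[of "d ` normalised T A" "I + 1 / real (Suc n)"] ne unfolding I_def by auto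
  then obtain F where F: "\<And>n. F n \<in> normalised T A" "\<And>n. d (F n) < I + 1 / real (Suc n)"
    by metis
  obtain r \<omega> where r: "strict_mono r" and \<omega>: "\<omega> \<in> normalised T A"
    and lim: "\<And>a. a \<in> Eff T A \<Longrightarrow> (\<lambda>n. pairing T a (F (r n))) \<longlonglongrightarrow> pairing T a \<omega>"
    using normalised_seq_compact[of F A] F(1) by blast
  have dlim: "(\<lambda>n. d (F (r n))) \<longlonglongrightarrow> d \<omega>"
    unfolding d_def using lim K(2) by (intro tendsto_intros) auto
  have Ilim: "(\<lambda>n. I + 1 / real (Suc n)) \<longlonglongrightarrow> I + 0"
    using LIMSEQ_inverse_real_of_nat by (intro tendsto_intros) (simp add: inverse_eq_divide)
  \<comment> \<open>Since \<open>r n\<close> is at least \<open>n\<close>, the bound for the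
    original sequence survives passing to the subsequence.\<close>
  have dle: "d (F (r n)) \<le> I + 1 / real (Suc n)" for n
  proof -
    have "1 / real (Suc (r n)) \<le> 1 / real (Suc n)"
      using seq_suble[OF r, of n] by (simp add: frac_le)
    then show ?thesis using F(2)[of "r n"] by linarith
  qed
  have "d \<omega> \<le> I + 0"
    using LIMSEQ_le[OF dlim Ilim] dle by blast
  then have min: "d \<omega> \<le> d \<sigma>" if "\<sigma> \<in> normalised T A" for \<sigma>
    using cINF_lower[OF bdd that] unfolding I_def by simp
  \<comment> \<open>Half the directional derivative of \<open>d\<close> at \<open>\<omega>\<close>
    towards \<open>\<sigma>\<close>.\<close>
  define L where "L \<sigma> = (\<Sum>k\<in>K. (pairing T k \<omega> - m k) * (pairing T k \<sigma> - pairing T k \<omega>))" for \<sigma>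
  have L: "L \<sigma> \<ge> 0" if \<sigma>: "\<sigma> \<in> normalised T A" for \<sigma>
  proof (rule ccontr)
    define Q where "Q = (\<Sum>k\<in>K. (pairing T k \<sigma> - pairing T k \<omega>)\<^sup>2)"
    assume "\<not> L \<sigma> \<ge> 0"
    then have neg: "L \<sigma> < 0" by simp
    have Q: "Q \<ge> 0" unfolding Q_def by (intro sum_nonneg) auto
    have ineq: "0 \<le> 2 * L \<sigma> + e * Q" if e: "0 < e" "e \<le> 1" for e
    proof -
      have square: "(e * s + (1 - e) * w - x)\<^sup>2 =
          (w - x)\<^sup>2 + 2 * e * ((w - x) * (s - w)) + e\<^sup>2 * (s - w)\<^sup>2" for s w x :: real
        by algebra
      \<comment> \<open>The point at parameter \<open>e\<close> on the segment from
        \<open>\<omega>\<close> to \<open>\<sigma>\<close>. Expanding \<open>d\<close> there, using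
        minimality and cancelling \<open>e\<close> gives the inequality.\<close>
      obtain \<tau> where \<tau>: "\<tau> \<in> normalised T A"
        "\<And>a. a \<in> Eff T A \<Longrightarrow> pairing T a \<tau> = e * pairing T a \<sigma> + (1 - e) * pairing T a \<omega>"
        using normalised_convex[OF \<sigma> \<omega>, of e] e by auto
      have "d \<tau> = (\<Sum>k\<in>K. (pairing T k \<omega> - m k)\<^sup>2
          + 2 * e * ((pairing T k \<omega> - m k) * (pairing T k \<sigma> - pairing T k \<omega>))
          + e\<^sup>2 * (pairing T k \<sigma> - pairing T k \<omega>)\<^sup>2)"
        unfolding d_def using \<tau>(2) K(2)
        by (intro sum.cong) (simp_all add: subset_iff square)
      also have "\<dots> = d \<omega> + 2 * e * L \<sigma> + e\<^sup>2 * Q"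
        unfolding d_def L_def Q_def by (simp add: sum.distrib sum_distrib_left)
      finally have "0 \<le> e * (2 * L \<sigma> + e * Q)"
        using min[OF \<tau>(1)] by (simp add: algebra_simps power2_eq_square)
      then show ?thesis using e by (simp add: zero_le_mult_iff)
    qed
    \<comment> \<open>Small enough that the quadratic term \<open>e * Q\<close> cannot exceed
      \<open>- L \<sigma>\<close>; the denominator \<open>Q + 1\<close> also covers
      \<open>Q = 0\<close>.\<close>
    define e where "e = min 1 (- L \<sigma> / (Q + 1))"
    have "e > 0" unfolding e_def using neg Q by (simp add: divide_simps)
    have "e * Q \<le> (- L \<sigma> / (Q + 1)) * Q"
      unfolding e_def using Q by (intro mult_right_mono) auto
    also have "\<dots> \<le> - L \<sigma>"
      using neg Q by (simp add: divide_simps algebra_simps)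
    finally have "2 * L \<sigma> + e * Q < 0" using neg by linarith
    with ineq[OF \<open>e > 0\<close>] show False by (simp add: e_def)
  qed
  have "0 \<le> (\<integral>x. L (f x) \<partial>M)"
    using L f by (intro integral_nonneg_AE AE_I2) auto
  \<comment> \<open>\<open>L\<close> is affine in the coordinates of its argument, so integrating
    replaces them by their averages \<open>m k\<close>, and the sum becomes
    \<open>- d \<omega>\<close>.\<close>
  also have "(\<integral>x. L (f x) \<partial>M) =
      (\<Sum>k\<in>K. (pairing T k \<omega> - m k) * (m k - pairing T k \<omega>))"
    unfolding L_def m_def using int K(2)
    by (subst Bochner_Integration.integral_sum) (auto simp: subset_iff M.prob_space)
  also have "\<dots> = - d \<omega>"
    unfolding d_def by (simp add: power2_eq_square algebra_simps flip: sum_negf)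
  finally have "d \<omega> \<le> 0" by simp
  moreover have "d \<omega> \<ge> 0"
    unfolding d_def by (intro sum_nonneg) simp
  ultimately have "d \<omega> = 0"
    by (rule antisym)
  then have mk: "pairing T k \<omega> = m k" if "k \<in> K" for k
    using that K(1) unfolding d_def by (subst (asm) sum_nonneg_eq_0_iff) auto
  \<comment> \<open>Agreement on the spanning effects \<open>K\<close> extends to every effect by
    linearity.\<close>
  have "pairing T a \<omega> = (\<integral>x. pairing T a (f x) \<partial>M)" if a: "a \<in> Eff T A" for a
  proof -
    from K(3)[OF a] obtain c
      where c: "\<And>\<rho>. \<rho> \<in> St T A \<Longrightarrow> pairing T a \<rho> = (\<Sum>k\<in>K. c k * pairing T k \<rho>)" by blast
    have "(\<integral>x. pairing T a (f x) \<partial>M) = (\<integral>x. (\<Sum>k\<in>K. c k * pairing T k (f x)) \<partial>M)"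
      using c f St by (intro Bochner_Integration.integral_cong) auto
    also have "\<dots> = (\<Sum>k\<in>K. c k * m k)"
      unfolding m_def using int K(2) by (subst Bochner_Integration.integral_sum) auto
    finally show ?thesis using c[OF St[OF \<omega>]] mk by simp
  qed
  with that \<omega> show ?thesis by blast
qed

section \<open>Reversible channels on pure states\<close>

text \<open>The inverse \<open>V\<close> pulls a refinement of \<open>U \<odot> \<psi>\<close> back
  to one of \<open>\<psi>\<close>. Purity makes its pieces multiples of \<open>\<psi>\<close>, and
  \<open>U\<close> carries these relations to \<open>B\<close>.\<close>

lemma reversible_pure_states:
  assumes U: "reversible T A B U" and \<psi>: "\<psi> \<in> pure_states T A"
  shows "U \<odot> \<psi> \<in> pure_states T B"
proof -
  obtain V where V: "channel T B A V" "V \<odot> U = Ident T A" "U \<odot> V = Ident T B"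
    using U unfolding reversible_def by auto
  have Uc: "channel T A B U" using U unfolding reversible_def by auto
  note Uin = channel_in_Tr[OF Uc] and Vin = channel_in_Tr[OF V(1)]
  have \<psi>St: "\<psi> \<in> St T A" and norm: "pairing T (discard T A) \<psi> = 1"
    and pure: "pure T (triv T) A \<psi>"
    using \<psi> by (auto simp: pure_states_def normalised_def)
  have \<psi>Tr: "\<psi> \<in> Tr T (triv T) A" using \<psi>St by (simp add: St_def)
  have U\<psi>: "U \<odot> \<psi> \<in> St T B" by (rule Seq_St[OF Uin \<psi>St])
  have VU: "V \<odot> (U \<odot> \<psi>) = \<psi>"
    using Seq_assoc[OF \<psi>Tr Uin Vin] V(2) \<psi>Tr by (simp add: Seq_Ident)
  have "pairing T (discard T B) (U \<odot> \<psi>) = 1"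
    using pairing_Seq[OF Uin \<psi>St discard_in_Eff] discard_channel[OF Uc] norm by simp
  moreover have "pure T (triv T) B (U \<odot> \<psi>)"
    unfolding pure_def
  proof (intro conjI allI impI ballI)
    show "U \<odot> \<psi> \<in> Tr T (triv T) B" using U\<psi> by (simp add: St_def)
    fix X F J i
    assume "Test T (triv T) B X F \<and> J \<subseteq> X \<and> is_sum T (triv T) B J F (U \<odot> \<psi>)" and i: "i \<in> J"
    then have F: "Test T (triv T) B X F" and J: "J \<subseteq> X"
      and sum: "is_sum T (triv T) B J F (U \<odot> \<psi>)" by auto
    have FSt: "F j \<in> St T B" if "j \<in> J" for j
      using F J that unfolding St_def Tr_iff_Test by blast
    \<comment> \<open>The test \<open>F\<close> followed by the one-outcome test \<open>V\<close>:
      outcome \<open>j\<close> is relabelled \<open>prod_encode (j, 0)\<close>.\<close>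
    define F' where "F' k = (case prod_decode k of (i, j) \<Rightarrow> V \<odot> F i)" for k
    define J' where "J' = (\<lambda>j. prod_encode (j, 0)) ` J"
    have T': "Test T (triv T) A (prod_encode ` (X \<times> {0})) F'"
      unfolding F'_def using Test_Seq[OF F V(1)[unfolded channel_def]] .
    have J': "J' \<subseteq> prod_encode ` (X \<times> {0})"
      unfolding J'_def using J by auto
    have F'eq: "F' (prod_encode (j, 0)) = V \<odot> F j" for j
      by (simp add: F'_def)
    have F'St: "F' k \<in> St T A" if "k \<in> J'" for k
      using that by (auto simp: J'_def F'eq FSt intro!: Seq_St[OF Vin])
    have inj: "inj_on (\<lambda>j. prod_encode (j, 0)) J"
      by (auto intro: inj_onI)
    have "is_sum T (triv T) A J' F' \<psi>"
    proof (subst lin_comb_state_iff[OF \<psi>St F'St], assumption, rule ballI)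
      fix a assume a: "a \<in> Eff T A"
      have "pairing T a \<psi> = pairing T (a \<odot> V) (U \<odot> \<psi>)"
        using pairing_Seq[OF Vin U\<psi> a] VU by simp
      also have "\<dots> = (\<Sum>j\<in>J. 1 * pairing T (a \<odot> V) (F j))"
        using lin_comb_state_iff[where F = F and J = J, THEN iffD1, OF U\<psi> FSt sum]
          Seq_Eff[OF Vin a] by blast
      also have "\<dots> = (\<Sum>j\<in>J. 1 * pairing T a (V \<odot> F j))"
        using FSt by (intro sum.cong) (simp_all add: pairing_Seq[OF Vin _ a])
      also have "\<dots> = (\<Sum>k\<in>J'. 1 * pairing T a (F' k))"
        unfolding J'_def by (simp add: sum.reindex[OF inj] F'eq)
      finally show "pairing T a \<psi> = (\<Sum>k\<in>J'. 1 * pairing T a (F' k))" .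
    qed
    then have "\<forall>k\<in>J'. \<exists>c. lin_comb T (triv T) A {()} (\<lambda>_. c) (\<lambda>_. \<psi>) (F' k)"
      using pure T' J' unfolding pure_def by blast
    then obtain c where "lin_comb T (triv T) A {()} (\<lambda>_. c) (\<lambda>_. \<psi>) (V \<odot> F i)"
      using i unfolding J'_def by (auto simp: F'eq)
    then have c: "pairing T b (V \<odot> F i) = c * pairing T b \<psi>" if "b \<in> Eff T A" for b
      using that by (subst (asm) lin_comb_state_iff[OF Seq_St[OF Vin FSt[OF i]] \<psi>St]) auto
    have UVF: "U \<odot> (V \<odot> F i) = F i"
      using FSt[OF i] Seq_assoc[OF _ Vin Uin, of "F i"] V(3) by (simp add: St_def Seq_Ident)
    have "pairing T a (F i) = c * pairing T a (U \<odot> \<psi>)" if a: "a \<in> Eff T B" for a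
      using c[OF Seq_Eff[OF Uin a]] pairing_Seq[OF Uin \<psi>St a]
        pairing_Seq[OF Uin Seq_St[OF Vin FSt[OF i]] a] UVF by simp
    then have "lin_comb T (triv T) B {()} (\<lambda>_. c) (\<lambda>_. U \<odot> \<psi>) (F i)"
      by (subst lin_comb_state_iff[OF FSt[OF i] U\<psi>]) auto
    then show "\<exists>c. lin_comb T (triv T) B {()} (\<lambda>_. c) (\<lambda>_. U \<odot> \<psi>) (F i)" ..
  qed
  ultimately show ?thesis
    using U\<psi> by (simp add: pure_states_def normalised_def)
qed

section \<open>Topology and Borel sets of pure states\<close>

lemma space_pure_borel: "space (pure_borel T A) = pure_states T A"
  unfolding pure_borel_def by (rule space_measure_of) (auto simp: openin_subtopology)

lemma sets_pure_borel: "sets (pure_borel T A) = sigma_sets (pure_states T A)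
    {V. openin (subtopology (state_topology T A) (pure_states T A)) V}"
  unfolding pure_borel_def by (rule sets_measure_of) (auto simp: openin_subtopology)

lemma openin_state_topology:
  "a \<in> Eff T A \<Longrightarrow> open U \<Longrightarrow> openin (state_topology T A) {\<rho> \<in> St T A. pairing T a \<rho> \<in> U}"
  unfolding state_topology_def by (rule topology_generated_by_Basis) blast

lemma topspace_state_topology: "topspace (state_topology T A) = St T A"
proof
  show "topspace (state_topology T A) \<subseteq> St T A"
    unfolding state_topology_def topology_generated_by_topspace by auto
  show "St T A \<subseteq> topspace (state_topology T A)"
    \<comment> \<open>The whole of \<open>St T A\<close> is itself a generating open set, taking the
      open set of reals to be \<open>UNIV\<close>.\<close>
    using openin_subset[OF openin_state_topology[OF discard_in_Eff open_UNIV, of A]] by simp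
qed

lemma pure_states_subset_St: "pure_states T A \<subseteq> St T A"
  by (auto simp: pure_states_def normalised_def)

lemma measurable_pairing:
  assumes a: "a \<in> Eff T A"
  shows "pairing T a \<in> borel_measurable (pure_borel T A)"
proof (rule borel_measurableI)
  fix S :: "real set" assume S: "open S"
  have "pairing T a -` S \<inter> space (pure_borel T A) =
      {\<rho> \<in> St T A. pairing T a \<rho> \<in> S} \<inter> pure_states T A"
    using pure_states_subset_St by (auto simp: space_pure_borel)
  moreover have "openin (subtopology (state_topology T A) (pure_states T A))
      ({\<rho> \<in> St T A. pairing T a \<rho> \<in> S} \<inter> pure_states T A)"
    using openin_state_topology[OF a S] by (auto simp: openin_subtopology)
  ultimately show "pairing T a -` S \<inter> space (pure_borel T A) \<in> sets (pure_borel T A)"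
    by (auto simp: sets_pure_borel)
qed

text \<open>The preimage of the generating set given by an effect \<open>a\<close> is the one given
  by the effect \<open>a \<odot> f\<close>.\<close>

lemma continuous_map_Seq:
  assumes f: "f \<in> Tr T A B"
  shows "continuous_map (state_topology T A) (state_topology T B) (\<lambda>\<rho>. f \<odot> \<rho>)"
  unfolding state_topology_def[of T B]
proof (rule continuous_on_generated_topo)
  fix W assume "W \<in> {{\<rho> \<in> St T B. pairing T a \<rho> \<in> U} | a U. a \<in> Eff T B \<and> open U}"
  then obtain a U where W: "W = {\<rho> \<in> St T B. pairing T a \<rho> \<in> U}" and a: "a \<in> Eff T B" and U: "open U"
    by blast
  have "(\<lambda>\<rho>. f \<odot> \<rho>) -` W \<inter> topspace (state_topology T A) = {\<rho> \<in> St T A. pairing T (a \<odot> f) \<rho> \<in> U}"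
    using Seq_St[OF f] pairing_Seq[OF f _ a] by (auto simp: topspace_state_topology W)
  then show "openin (state_topology T A) ((\<lambda>\<rho>. f \<odot> \<rho>) -` W \<inter> topspace (state_topology T A))"
    using openin_state_topology[OF Seq_Eff[OF f a] U] by simp
next
  show "(\<lambda>\<rho>. f \<odot> \<rho>) ` topspace (state_topology T A)
      \<subseteq> \<Union>{{\<rho> \<in> St T B. pairing T a \<rho> \<in> U} | a U. a \<in> Eff T B \<and> open U}"
    using Seq_St[OF f] topspace_state_topology[of B]
    unfolding topspace_state_topology[of A] state_topology_def[of T B] topology_generated_by_topspace
    by auto
qed

lemma measurable_reversible:
  assumes U: "reversible T A B U"
  shows "(\<lambda>\<psi>. U \<odot> \<psi>) \<in> pure_borel T A \<rightarrow>\<^sub>M pure_borel T B"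
proof (rule measurable_sigma_sets[OF sets_pure_borel])
  show "{V. openin (subtopology (state_topology T B) (pure_states T B)) V} \<subseteq> Pow (pure_states T B)"
    by (auto simp: openin_subtopology)
  show into: "(\<lambda>\<psi>. U \<odot> \<psi>) \<in> space (pure_borel T A) \<rightarrow> pure_states T B"
    using reversible_pure_states[OF U] by (auto simp: space_pure_borel)
  fix W assume "W \<in> {V. openin (subtopology (state_topology T B) (pure_states T B)) V}"
  then obtain W' where W': "openin (state_topology T B) W'" "W = W' \<inter> pure_states T B"
    by (auto simp: openin_subtopology)
  have "openin (state_topology T A) {\<rho> \<in> topspace (state_topology T A). U \<odot> \<rho> \<in> W'}"
    using openin_continuous_map_preimage[OF continuous_map_Seq[OF reversible_in_Tr[OF U]] W'(1)] .
  moreover have "(\<lambda>\<psi>. U \<odot> \<psi>) -` W \<inter> space (pure_borel T A) =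
      {\<rho> \<in> topspace (state_topology T A). U \<odot> \<rho> \<in> W'} \<inter> pure_states T A"
    using into pure_states_subset_St by (auto simp: W'(2) space_pure_borel topspace_state_topology)
  ultimately have "openin (subtopology (state_topology T A) (pure_states T A))
      ((\<lambda>\<psi>. U \<odot> \<psi>) -` W \<inter> space (pure_borel T A))"
    by (auto simp: openin_subtopology)
  then show "(\<lambda>\<psi>. U \<odot> \<psi>) -` W \<inter> space (pure_borel T A) \<in> sets (pure_borel T A)"
    by (auto simp: sets_pure_borel)
qed

text \<open>Invariance of the image measure under \<open>W\<close> is invariance of
  \<open>\<mu>\<close> under the conjugate of \<open>W\<close> by \<open>U\<close>.\<close>

lemma invariant_measure_reversible:
  assumes \<mu>: "invariant_measure T A \<mu>" and U: "reversible T A B U"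
  shows "invariant_measure T B (distr \<mu> (pure_borel T B) (\<lambda>\<psi>. U \<odot> \<psi>))"
proof -
  have \<mu>': "prob_space \<mu>" "sets \<mu> = sets (pure_borel T A)"
    "\<And>W. reversible T A A W \<Longrightarrow> distr \<mu> (pure_borel T A) (\<lambda>\<psi>. W \<odot> \<psi>) = \<mu>"
    using \<mu> by (auto simp: invariant_measure_def)
  have meas: "(\<lambda>\<psi>. W \<odot> \<psi>) \<in> \<mu> \<rightarrow>\<^sub>M pure_borel T C" if "reversible T A C W" for C W
    using measurable_reversible[OF that] measurable_cong_sets[OF \<mu>'(2) refl] by blast
  have space: "space \<mu> = pure_states T A"
    using sets_eq_imp_space_eq[OF \<mu>'(2)] by (simp add: space_pure_borel)
  obtain V where V: "channel T B A V" "V \<odot> U = Ident T A" "U \<odot> V = Ident T B"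
    using U unfolding reversible_def by auto
  have Vr: "reversible T B A V"
    using U V unfolding reversible_def by auto
  note Uin = reversible_in_Tr[OF U] and Vin = channel_in_Tr[OF V(1)]
  show ?thesis
    unfolding invariant_measure_def
  proof (intro conjI allI impI)
    show "prob_space (distr \<mu> (pure_borel T B) (\<lambda>\<psi>. U \<odot> \<psi>))"
      by (rule prob_space.prob_space_distr[OF \<mu>'(1) meas[OF U]])
    show "sets (distr \<mu> (pure_borel T B) (\<lambda>\<psi>. U \<odot> \<psi>)) = sets (pure_borel T B)"
      by simp
    fix W assume W: "reversible T B B W"
    define W' where "W' = V \<odot> (W \<odot> U)"
    have W': "reversible T A A W'"
      unfolding W'_def by (intro reversible_Seq[OF _ Vr] reversible_Seq[OF U W])
    have Win: "W \<in> Tr T B B" by (rule reversible_in_Tr[OF W])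
    \<comment> \<open>Intertwining relation \<open>W U = U W'\<close>, which moves \<open>W\<close>
      inside the first push-forward.\<close>
    have eq: "W \<odot> (U \<odot> \<psi>) = U \<odot> (W' \<odot> \<psi>)" if "\<psi> \<in> pure_states T A" for \<psi>
    proof -
      have \<psi>: "\<psi> \<in> Tr T (triv T) A" using that pure_states_subset_St by (auto simp: St_def)
      have WU: "W \<odot> U \<in> Tr T A B" using Seq_in[OF Uin Win] .
      have "U \<odot> W' = W \<odot> U"
        unfolding W'_def using Seq_assoc[OF WU Vin Uin] V(3) WU by (simp add: Seq_Ident)
      then show ?thesis
        using Seq_assoc[OF \<psi> Uin Win] Seq_assoc[OF \<psi> reversible_in_Tr[OF W'] Uin] by simp
    qed
    have "distr (distr \<mu> (pure_borel T B) (\<lambda>\<psi>. U \<odot> \<psi>)) (pure_borel T B) (\<lambda>\<psi>. W \<odot> \<psi>) =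
        distr \<mu> (pure_borel T B) (\<lambda>\<psi>. W \<odot> (U \<odot> \<psi>))"
      using distr_distr[OF measurable_reversible[OF W] meas[OF U]] by (simp add: o_def)
    also have "\<dots> = distr \<mu> (pure_borel T B) (\<lambda>\<psi>. U \<odot> (W' \<odot> \<psi>))"
      by (rule distr_cong) (auto simp: space eq)
    also have "\<dots> = distr (distr \<mu> (pure_borel T A) (\<lambda>\<psi>. W' \<odot> \<psi>)) (pure_borel T B) (\<lambda>\<psi>. U \<odot> \<psi>)"
      using distr_distr[OF measurable_reversible[OF U] meas[OF W']] by (simp add: o_def)
    finally show "distr (distr \<mu> (pure_borel T B) (\<lambda>\<psi>. U \<odot> \<psi>)) (pure_borel T B) (\<lambda>\<psi>. W \<odot> \<psi>) =
        distr \<mu> (pure_borel T B) (\<lambda>\<psi>. U \<odot> \<psi>)"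
      using \<mu>'(3)[OF W'] by simp
  qed
qed

end

section \<open>Noisy operations are unital\<close>

context microcanonical_theory
begin

section \<open>The microcanonical measure and state\<close>

lemma invariant_micro_measure: "invariant_measure T A (micro_measure T A)"
  unfolding micro_measure_def by (rule theI'[OF ex1_invariant_measure])

lemma micro_measure_eqI: "invariant_measure T A \<mu> \<Longrightarrow> \<mu> = micro_measure T A"
  using ex1_invariant_measure invariant_micro_measure by blast

lemma measurable_micro_measure:
  "f \<in> pure_borel T A \<rightarrow>\<^sub>M N \<longleftrightarrow> f \<in> micro_measure T A \<rightarrow>\<^sub>M N"
  using invariant_micro_measure[of A] unfolding invariant_measure_def
  by (metis measurable_cong_sets)

lemma space_micro_measure: "space (micro_measure T A) = pure_states T A"
  using invariant_micro_measure[of A] unfolding invariant_measure_def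
  by (metis sets_eq_imp_space_eq space_pure_borel)

text \<open>\<open>micro_state\<close> is a definite description: \<open>barycentre_exists\<close>
  gives existence, and separation of states by effects gives uniqueness.\<close>

lemma micro_state_normalised: "micro_state T A \<in> normalised T A"
  and pairing_micro_state:
    "a \<in> Eff T A \<Longrightarrow> pairing T a (micro_state T A) = (\<integral>\<psi>. pairing T a \<psi> \<partial>micro_measure T A)"
proof -
  have "prob_space (micro_measure T A)"
    using invariant_micro_measure[of A] by (simp add: invariant_measure_def)
  then obtain \<omega> where \<omega>: "\<omega> \<in> normalised T A"
    "\<And>a. a \<in> Eff T A \<Longrightarrow> pairing T a \<omega> = (\<integral>\<psi>. pairing T a \<psi> \<partial>micro_measure T A)"
    by (rule barycentre_exists[where f = "\<lambda>\<psi>. \<psi>" and A = A])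
      (auto simp: space_micro_measure pure_states_def
        intro: measurable_pairing[unfolded measurable_micro_measure])
  have "micro_state T A = \<omega>"
    unfolding micro_state_def
  proof (rule the_equality)
    show "\<omega> \<in> St T A \<and> (\<forall>a\<in>Eff T A. pairing T a \<omega> = (\<integral>\<psi>. pairing T a \<psi> \<partial>micro_measure T A))"
      using \<omega> by (simp add: normalised_def)
  qed (use \<omega> in \<open>auto simp: normalised_def intro: St_eqI\<close>)
  with \<omega> show "micro_state T A \<in> normalised T A"
    and "a \<in> Eff T A \<Longrightarrow> pairing T a (micro_state T A) = (\<integral>\<psi>. pairing T a \<psi> \<partial>micro_measure T A)"
    by simp_all
qed

lemma micro_state_in_St: "micro_state T A \<in> St T A"
  using micro_state_normalised by (simp add: normalised_def)

lemma reversible_micro_state: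
  assumes U: "reversible T A B U"
  shows "U \<odot> micro_state T A = micro_state T B"
proof (rule St_eqI[OF Seq_St[OF reversible_in_Tr[OF U] micro_state_in_St] micro_state_in_St])
  fix a assume a: "a \<in> Eff T B"
  note Uin = reversible_in_Tr[OF U]
  have "pairing T a (micro_state T B) = (\<integral>\<psi>. pairing T a \<psi> \<partial>micro_measure T B)"
    by (rule pairing_micro_state[OF a])
  \<comment> \<open>Uniqueness of the invariant measure on \<open>B\<close>; the rest is a change of
    variables.\<close>
  also have "micro_measure T B = distr (micro_measure T A) (pure_borel T B) (\<lambda>\<psi>. U \<odot> \<psi>)"
    using micro_measure_eqI[OF invariant_measure_reversible[OF invariant_micro_measure U]] by simp
  also have "(\<integral>\<psi>. pairing T a \<psi> \<partial>\<dots>) = (\<integral>\<psi>. pairing T a (U \<odot> \<psi>) \<partial>micro_measure T A)"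
    by (rule integral_distr[OF measurable_reversible[OF U, unfolded measurable_micro_measure]
          measurable_pairing[OF a]])
  also have "\<dots> = (\<integral>\<psi>. pairing T (a \<odot> U) \<psi> \<partial>micro_measure T A)"
    using pairing_Seq[OF Uin _ a] pure_states_subset_St
    by (intro Bochner_Integration.integral_cong) (auto simp: space_micro_measure)
  also have "\<dots> = pairing T (a \<odot> U) (micro_state T A)"
    by (rule pairing_micro_state[OF Seq_Eff[OF Uin a], symmetric])
  also have "\<dots> = pairing T a (U \<odot> micro_state T A)"
    by (rule pairing_Seq[OF Uin micro_state_in_St a, symmetric])
  finally show "pairing T a (U \<odot> micro_state T A) = pairing T a (micro_state T B)" by simp
qed

text \<open>Preparing the ancilla turns the microcanonical state of \<open>A\<close> into that of
  \<open>A \<boxtimes> E\<close>, \<open>U\<close> sends it to that of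
  \<open>A' \<boxtimes> E'\<close>, and discarding one tensor factor leaves that of
  \<open>A'\<close>.\<close>

lemma basic_noisy_unital:
  assumes "basic_noisy T A A' B"
  shows "B \<odot> micro_state T A = micro_state T A'"
proof -
  obtain E E' U where U: "reversible T (A \<boxtimes> E) (A' \<boxtimes> E') U"
    and B: "B = (Ident T A' \<otimes> discard T E') \<odot> U \<odot> (Ident T A \<otimes> micro_state T E)"
    using assms unfolding basic_noisy_def by auto
  have \<chi>: "micro_state T X \<in> Tr T (triv T) X" for X
    using micro_state_in_St by (simp add: St_def)
  have u: "discard T X \<in> Tr T X (triv T)" for X
    using discard_in_Eff by (simp add: Eff_def)
  have Uin: "U \<in> Tr T (A \<boxtimes> E) (A' \<boxtimes> E')"
    by (rule reversible_in_Tr[OF U])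
  have prep: "Ident T A \<otimes> micro_state T E \<in> Tr T A (A \<boxtimes> E)"
    using Par_in[OF Ident_in \<chi>, of A E] by (simp add: comp_triv)
  have disc: "Ident T A' \<otimes> discard T E' \<in> Tr T (A' \<boxtimes> E') A'"
    using Par_in[OF Ident_in u, of A' E'] by (simp add: comp_triv)
  \<comment> \<open>A trivial wire is inserted so that the interchange law applies.\<close>
  have "(Ident T A \<otimes> micro_state T E) \<odot> micro_state T A =
      (Ident T A \<otimes> micro_state T E) \<odot> (micro_state T A \<otimes> Ident T (triv T))"
    by (simp add: Par_triv(1)[OF \<chi>])
  also have "\<dots> = micro_state T (A \<boxtimes> E)"
    using Par_Seq[OF \<chi> Ident_in Ident_in \<chi>, of A E]
    by (simp add: Seq_Ident[OF \<chi>] micro_state_Comp)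
  finally have prep_eq: "(Ident T A \<otimes> micro_state T E) \<odot> micro_state T A = micro_state T (A \<boxtimes> E)" .
  have "discard T E' \<odot> micro_state T E' = Ident T (triv T)"
    using micro_state_normalised[of E'] pairing_in_Tr[OF discard_in_Eff micro_state_in_St]
    by (intro num_eq_1_imp_Ident) (auto simp: normalised_def pairing_def)
  then have disc_eq: "(Ident T A' \<otimes> discard T E') \<odot> micro_state T (A' \<boxtimes> E') = micro_state T A'"
    using Par_Seq[OF \<chi> Ident_in \<chi> u, of A' E']
    by (simp add: Seq_Ident[OF \<chi>] Par_triv(1)[OF \<chi>] micro_state_Comp)
  have "B \<odot> micro_state T A = ((Ident T A' \<otimes> discard T E') \<odot> U) \<odot> micro_state T (A \<boxtimes> E)"
    unfolding B using Seq_assoc[OF \<chi> prep Seq_in[OF Uin disc]] prep_eq by simp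
  also have "\<dots> = (Ident T A' \<otimes> discard T E') \<odot> micro_state T (A' \<boxtimes> E')"
    using Seq_assoc[OF \<chi> Uin disc] reversible_micro_state[OF U] by simp
  finally show ?thesis using disc_eq by simp
qed

lemma noisy_operation_unital:
  assumes "noisy_operation T A A' N"
  shows "unital T A A' N"
proof -
  obtain B where N: "N \<in> Tr T A A'" and B: "\<And>n. basic_noisy T A A' (B n)"
    and lim: "converges T A A' B N"
    using assms unfolding noisy_operation_def by auto
  have Bc: "channel T A A' (B n)" for n
    using B[of n] by (simp add: basic_noisy_def)
  have "N \<odot> micro_state T A = micro_state T A'"
  proof (rule St_eqI[OF Seq_St[OF N micro_state_in_St] micro_state_in_St])
    fix a assume "a \<in> Eff T A'"
    \<comment> \<open>With a trivial ancilla and input \<open>micro_state T A\<close>, convergence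
      concerns a sequence that is constant by \<open>basic_noisy_unital\<close>.\<close>
    then have "(\<lambda>n. probe T (triv T) a (micro_state T A) (B n))
        \<longlonglongrightarrow> probe T (triv T) a (micro_state T A) N"
      using lim micro_state_in_St[of A] unfolding converges_def by (simp add: comp_triv)
    then show "pairing T a (N \<odot> micro_state T A) = pairing T a (micro_state T A')"
      by (simp add: probe_triv[OF N] probe_triv[OF channel_in_Tr[OF Bc]]
          basic_noisy_unital[OF B] LIMSEQ_const_iff)
  qed
  with channel_limit[OF N Bc lim] show ?thesis
    unfolding unital_def by blast
qed

end

theorem proposition5p2p5:
  fixes T :: "('s, 't) opt" and A A' :: 's and N :: 't
  assumes "microcanonical_theory T"
    and "noisy_operation T A A' N"
  shows "unital T A A' N"
  using assms by (rule microcanonical_theory.noisy_operation_unital)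

end
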